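(* Let $G_1,G_2$ be graphs with $G_1\prec_{cc}G_2$, and suppose that it is not the case that both $G_1\approx_{cc}K_1$ and $G_2\approx_{cc}K_2$. Then there is a graph $G$ such that $$G_1\prec_{cc}G\prec_{cc}G_2 .$$
   Context: Graphs are finite, undirected and loopless. A cut in a graph $G=(V,E)$ is the set of all edges with one end in $X$ and the other in $V\setminus X$, for some $X\subseteq V$ (so the empty set is a cut). A mapping $f:E(G)\to E(H)$ is cut-continuous if for every cut $C$ of $H$ the preimage $f^{-1}(C)$ is a cut of $G$. Write $G\preccurlyeq_{cc}H$ if there is a cut-continuous mapping $E(G)\to E(H)$; $G\approx_{cc}H$ if $G\preccurlyeq_{cc}H$ and $H\preccurlyeq_{cc}G$; and $G\prec_{cc}H$ if $G\preccurlyeq_{cc}H$ but not $H\preccurlyeq_{cc}G$. $K_n$ is the complete graph on $n$ vertices. *)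

theory Defs
  imports Main
begin

text \<open>
  Edges have their own identity and are mapped to their sets of ends, so parallel edges are
  allowed; loops are excluded because the set of ends has two elements.
\<close>

record ('v, 'e) graph =
  verts :: "'v set"
  edges :: "'e set"
  ends :: "'e \<Rightarrow> 'v set"

definition finite_graph :: "('v, 'e) graph \<Rightarrow> bool" where
  "finite_graph G \<longleftrightarrow> finite (verts G) \<and> finite (edges G) \<and>
     (\<forall>e\<in>edges G. ends G e \<subseteq> verts G \<and> card (ends G e) = 2)"

definition complete_graph :: "nat \<Rightarrow> (nat, nat set) graph" where
  "complete_graph n =
     \<lparr> verts = {1..n}, edges = {e. e \<subseteq> {1..n} \<and> card e = 2}, ends = (\<lambda>e. e) \<rparr>"

definition edges_between :: "('v, 'e) graph \<Rightarrow> 'v set \<Rightarrow> 'v set \<Rightarrow> 'e set" where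
  "edges_between G X Y = {e \<in> edges G. \<exists>x\<in>X. \<exists>y\<in>Y. ends G e = {x, y}}"

definition is_cut :: "('v, 'e) graph \<Rightarrow> 'e set \<Rightarrow> bool" where
  "is_cut G C \<longleftrightarrow> (\<exists>X. X \<subseteq> verts G \<and> C = edges_between G X (verts G - X))"

text \<open>A map between edge sets is a total function of which only the values on \<open>edges G\<close> matter.\<close>

definition cut_continuous ::
    "('v, 'e) graph \<Rightarrow> ('w, 'f) graph \<Rightarrow> ('e \<Rightarrow> 'f) \<Rightarrow> bool" where
  "cut_continuous G H f \<longleftrightarrow> f ` edges G \<subseteq> edges H \<and>
     (\<forall>C. is_cut H C \<longrightarrow> is_cut G {e \<in> edges G. f e \<in> C})"

definition cc_le :: "('v, 'e) graph \<Rightarrow> ('w, 'f) graph \<Rightarrow> bool"  (infix "\<preceq>cc" 50) where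
  "G \<preceq>cc H \<longleftrightarrow> (\<exists>f. cut_continuous G H f)"

definition cc_equiv :: "('v, 'e) graph \<Rightarrow> ('w, 'f) graph \<Rightarrow> bool"  (infix "\<approx>cc" 50) where
  "G \<approx>cc H \<longleftrightarrow> G \<preceq>cc H \<and> H \<preceq>cc G"

definition cc_less :: "('v, 'e) graph \<Rightarrow> ('w, 'f) graph \<Rightarrow> bool"  (infix "\<prec>cc" 50) where
  "G \<prec>cc H \<longleftrightarrow> G \<preceq>cc H \<and> \<not> H \<preceq>cc G"

end

theory Submission
  imports Defs "HOL-Library.Ramsey"
begin

text \<open>
  A cut-continuous map \<open>f\<close> from \<open>G\<close> to \<open>H\<close> is the same as a map \<open>\<phi>\<close> from the vertices of \<open>G\<close> to
  the sets of vertices of \<open>H\<close> such that every edge \<open>e = uv\<close> satisfies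
  \<open>\<phi> u \<triangle> \<phi> v = ends (f e)\<close>: the preimages of the vertex stars of \<open>H\<close> are the cuts defined by \<open>\<phi>\<close>.

  Take \<open>G\<close> to be the disjoint union of \<open>G\<^sub>1\<close> and \<open>K = G\<^sub>2 \<times> W\<close>, where \<open>W\<close> is the shift graph on the
  \<open>k\<close>-subsets of a large initial segment of the naturals. If \<open>K\<close> mapped to \<open>G\<^sub>1\<close>, then colouring a
  vertex of \<open>W\<close> by the restriction of \<open>\<phi>\<close> to its fibre and applying Ramsey's theorem would give
  two adjacent vertices of the same colour, hence a map from \<open>G\<^sub>2\<close> to \<open>G\<^sub>1\<close>. On the other hand, sets of
  few edges of \<open>W\<close>, and hence of \<open>K\<close>, are bipartite. So if \<open>G\<^sub>2\<close> mapped to \<open>G\<close>, then the edges in the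
  part of the image that lies in \<open>K\<close> could be sent to one edge of \<open>G\<^sub>1\<close>, or of \<open>K\<^sub>2\<close> if \<open>G\<^sub>1\<close> has no edge.
\<close>

section \<open>Cut-continuous maps as potentials\<close>

text \<open>\<open>f\<close> stays a separate argument because \<open>\<phi>\<close> determines only
  the ends of the image of an edge, and \<open>H\<close> may have parallel edges.\<close>

definition cc_potential ::
    "('v, 'e) graph \<Rightarrow> ('w, 'f) graph \<Rightarrow> ('v \<Rightarrow> 'w set) \<Rightarrow> ('e \<Rightarrow> 'f) \<Rightarrow> bool" where
  "cc_potential G H \<phi> f \<longleftrightarrow> f ` edges G \<subseteq> edges H \<and> \<phi> ` verts G \<subseteq> Pow (verts H) \<and>
     (\<forall>e\<in>edges G. \<forall>u v. ends G e = {u, v} \<longrightarrow> sym_diff (\<phi> u) (\<phi> v) = ends H (f e))"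

lemma finite_graph_endsE:
  assumes "finite_graph G" "e \<in> edges G"
  obtains u v where "ends G e = {u, v}" "u \<noteq> v" "u \<in> verts G" "v \<in> verts G"
proof -
  have "card (ends G e) = 2" "ends G e \<subseteq> verts G"
    using assms by (auto simp: finite_graph_def)
  then show ?thesis
    using that by (auto simp: card_2_iff)
qed

lemma mem_edges_between_iff:
  assumes "e \<in> edges G" "ends G e = {u, v}" "u \<in> verts G" "v \<in> verts G"
  shows "e \<in> edges_between G X (verts G - X) \<longleftrightarrow> (u \<in> X) \<noteq> (v \<in> X)"
  using assms by (auto simp: edges_between_def doubleton_eq_iff)

lemma odd_card_sym_diff:
  assumes "finite A" "finite B"
  shows "odd (card (sym_diff A B)) \<longleftrightarrow> odd (card A) \<noteq> odd (card B)"
proof -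
  have "card (sym_diff A B) = card (A - B) + card (B - A)"
    using assms by (intro card_Un_disjoint) auto
  moreover have "card A = card (A - B) + card (A \<inter> B)"
    using assms by (subst card_Un_disjoint [symmetric]) (auto intro: arg_cong [where f = card])
  moreover have "card B = card (B - A) + card (A \<inter> B)"
    using assms by (subst card_Un_disjoint [symmetric]) (auto intro: arg_cong [where f = card])
  ultimately show ?thesis
    by presburger
qed

text \<open>Parity of the intersection with \<open>X\<close> is additive under symmetric difference,
  and a pair of ends meets \<open>X\<close> in an odd number of vertices exactly when its edge
  crosses the cut. So the vertices \<open>v\<close> with \<open>\<phi> v \<inter> X\<close> odd form
  one side of the preimage.\<close>

lemma cut_continuous_of_potential:
  assumes G: "finite_graph G" and H: "finite_graph H" and pot: "cc_potential G H \<phi> f"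
  shows "cut_continuous G H f"
  unfolding cut_continuous_def
proof (intro conjI allI impI)
  show fE: "f ` edges G \<subseteq> edges H"
    using pot by (simp add: cc_potential_def)
  fix C assume "is_cut H C"
  then obtain X where X: "X \<subseteq> verts H" "C = edges_between H X (verts H - X)"
    by (auto simp: is_cut_def)
  define Y where "Y = {v \<in> verts G. odd (card (\<phi> v \<inter> X))}"
  have finX: "finite X"
    using X(1) H by (auto simp: finite_graph_def intro: finite_subset)
  have "f e \<in> C \<longleftrightarrow> e \<in> edges_between G Y (verts G - Y)" if e: "e \<in> edges G" for e
  proof -
    obtain u v where uv: "ends G e = {u, v}" "u \<noteq> v" "u \<in> verts G" "v \<in> verts G"
      using finite_graph_endsE [OF G e] .
    have feE: "f e \<in> edges H"
      using fE e by auto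
    obtain a b where ab: "ends H (f e) = {a, b}" "a \<noteq> b" "a \<in> verts H" "b \<in> verts H"
      using finite_graph_endsE [OF H feE] .
    have sd: "sym_diff (\<phi> u) (\<phi> v) = {a, b}"
      using pot e uv(1) ab(1) by (simp add: cc_potential_def)
    have "sym_diff (\<phi> u \<inter> X) (\<phi> v \<inter> X) = {a, b} \<inter> X"
      using sd by auto
    moreover have "odd (card ({a, b} \<inter> X)) \<longleftrightarrow> (a \<in> X) \<noteq> (b \<in> X)"
      using ab(2) by (auto simp: Int_insert_left)
    moreover have "f e \<in> C \<longleftrightarrow> (a \<in> X) \<noteq> (b \<in> X)"
      unfolding X(2) by (rule mem_edges_between_iff [OF feE ab(1,3,4)])
    moreover have "e \<in> edges_between G Y (verts G - Y) \<longleftrightarrow> (u \<in> Y) \<noteq> (v \<in> Y)"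
      by (rule mem_edges_between_iff [OF e uv(1,3,4)])
    ultimately show ?thesis
      using odd_card_sym_diff [of "\<phi> u \<inter> X" "\<phi> v \<inter> X"] finX uv(3,4) by (simp add: Y_def)
  qed
  then have "{e \<in> edges G. f e \<in> C} = edges_between G Y (verts G - Y)"
    by (auto simp: edges_between_def)
  moreover have "Y \<subseteq> verts G"
    by (auto simp: Y_def)
  ultimately show "is_cut G {e \<in> edges G. f e \<in> C}"
    by (auto simp: is_cut_def)
qed

lemma potential_of_cut_continuous:
  assumes G: "finite_graph G" and H: "finite_graph H" and f: "cut_continuous G H f"
  obtains \<phi> where "cc_potential G H \<phi> f"
proof -
  have fE: "f ` edges G \<subseteq> edges H"
    using f by (simp add: cut_continuous_def)
  have "\<exists>Y. {e \<in> edges G. f e \<in> edges_between H {w} (verts H - {w})} =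
      edges_between G Y (verts G - Y)" if "w \<in> verts H" for w
  proof -
    have "is_cut H (edges_between H {w} (verts H - {w}))"
      using that by (auto simp: is_cut_def)
    then have "is_cut G {e \<in> edges G. f e \<in> edges_between H {w} (verts H - {w})}"
      using f by (simp add: cut_continuous_def)
    then show ?thesis
      unfolding is_cut_def by blast
  qed
  then obtain Y where Y: "\<And>w. w \<in> verts H \<Longrightarrow>
      {e \<in> edges G. f e \<in> edges_between H {w} (verts H - {w})} =
        edges_between G (Y w) (verts G - Y w)"
    by metis
  \<comment> \<open>\<open>Y w\<close> is one side of the preimage of the star of \<open>w\<close>;
    \<open>\<phi>\<close> transposes this incidence. The choice of side is harmless: the other side
    toggles \<open>w\<close> in every value of \<open>\<phi>\<close> on \<open>verts G\<close>, and
    symmetric differences do not change.\<close>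
  define \<phi> where "\<phi> v = {w \<in> verts H. v \<in> Y w}" for v
  have "sym_diff (\<phi> u) (\<phi> v) = ends H (f e)" if e: "e \<in> edges G" and uv: "ends G e = {u, v}" for e u v
  proof -
    have uvV: "u \<in> verts G" "v \<in> verts G"
      using G e uv unfolding finite_graph_def by auto
    have feE: "f e \<in> edges H"
      using fE e by auto
    obtain a b where ab: "ends H (f e) = {a, b}" "a \<noteq> b" "a \<in> verts H" "b \<in> verts H"
      using finite_graph_endsE [OF H feE] .
    have "(u \<in> Y w) \<noteq> (v \<in> Y w) \<longleftrightarrow> w \<in> {a, b}" if w: "w \<in> verts H" for w
    proof -
      have "(u \<in> Y w) \<noteq> (v \<in> Y w) \<longleftrightarrow> e \<in> edges_between G (Y w) (verts G - Y w)"
        using mem_edges_between_iff [OF e uv uvV] by simp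
      also have "\<dots> \<longleftrightarrow> f e \<in> edges_between H {w} (verts H - {w})"
        using Y [OF w, symmetric] e by simp
      also have "\<dots> \<longleftrightarrow> w \<in> {a, b}"
        using mem_edges_between_iff [OF feE ab(1,3,4)] ab(2) by auto
      finally show ?thesis .
    qed
    then show ?thesis
      using ab by (auto simp: \<phi>_def)
  qed
  then have "cc_potential G H \<phi> f"
    using fE by (auto simp: cc_potential_def \<phi>_def)
  then show ?thesis
    by (rule that)
qed

section \<open>The quasi-order of cut-continuous maps\<close>

lemma cc_le_iff_potential:
  assumes "finite_graph G" "finite_graph H"
  shows "G \<preceq>cc H \<longleftrightarrow> (\<exists>\<phi> f. cc_potential G H \<phi> f)"
  using cut_continuous_of_potential [OF assms] potential_of_cut_continuous [OF assms]
  unfolding cc_le_def by metis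

lemma cc_le_trans:
  assumes "G \<preceq>cc H" "H \<preceq>cc K"
  shows "G \<preceq>cc K"
proof -
  obtain f g where f: "cut_continuous G H f" and g: "cut_continuous H K g"
    using assms by (auto simp: cc_le_def)
  have "is_cut G {e \<in> edges G. (g \<circ> f) e \<in> C}" if "is_cut K C" for C
  proof -
    have "is_cut H {e \<in> edges H. g e \<in> C}"
      using g that by (simp add: cut_continuous_def)
    then have "is_cut G {e \<in> edges G. f e \<in> {e \<in> edges H. g e \<in> C}}"
      using f unfolding cut_continuous_def by blast
    moreover have "{e \<in> edges G. f e \<in> {e \<in> edges H. g e \<in> C}} = {e \<in> edges G. (g \<circ> f) e \<in> C}"
      using f by (auto simp: cut_continuous_def)
    ultimately show ?thesis
      by simp
  qed
  moreover have "(g \<circ> f) ` edges G \<subseteq> edges K"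
    using f g by (fastforce simp: cut_continuous_def)
  ultimately have "cut_continuous G K (g \<circ> f)"
    by (simp add: cut_continuous_def)
  then show ?thesis
    by (auto simp: cc_le_def)
qed

lemma cc_le_edgeless:
  assumes "finite_graph G" "finite_graph H" "edges G = {}"
  shows "G \<preceq>cc H"
proof -
  have "cc_potential G H (\<lambda>_. {}) f" for f
    using assms(3) by (auto simp: cc_potential_def)
  then show ?thesis
    using assms by (auto simp: cc_le_iff_potential)
qed

text \<open>A homomorphism yields a potential with singleton values. Since \<open>H\<close> has no
  loops, the two ends of an edge get distinct singletons, whose symmetric difference is the image
  pair.\<close>

lemma cc_le_hom:
  assumes "finite_graph G" "finite_graph H" "h ` verts G \<subseteq> verts H" "f ` edges G \<subseteq> edges H"
    and "\<And>e. e \<in> edges G \<Longrightarrow> ends H (f e) = h ` ends G e"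
  shows "G \<preceq>cc H"
proof -
  have "cc_potential G H (\<lambda>v. {h v}) f"
    unfolding cc_potential_def
  proof (intro conjI ballI allI impI)
    fix e u v assume e: "e \<in> edges G" and uv: "ends G e = {u, v}"
    have "f e \<in> edges H"
      using assms(4) e by auto
    then have "card (ends H (f e)) = 2"
      using assms(2) by (simp add: finite_graph_def)
    then have "card {h u, h v} = 2"
      using assms(5) [OF e] uv by simp
    then have "h u \<noteq> h v"
      by auto
    then show "sym_diff {h u} {h v} = ends H (f e)"
      using assms(5) [OF e] uv by auto
  qed (use assms in auto)
  then show ?thesis
    using assms(1,2) by (auto simp: cc_le_iff_potential)
qed

text \<open>Serves to bring the final witness, built on sum and product types, to the vertex and
  edge type \<open>nat\<close>.\<close>

lemma nat_graph_copy:
  assumes G: "finite_graph G"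
  obtains G' :: "(nat, nat) graph" where "finite_graph G'" "G \<preceq>cc G'" "G' \<preceq>cc G"
proof -
  obtain h :: "'a \<Rightarrow> nat" where h: "inj_on h (verts G)"
    using G finite_imp_inj_to_nat_seg [of "verts G"] by (auto simp: finite_graph_def)
  obtain f :: "'b \<Rightarrow> nat" where f: "inj_on f (edges G)"
    using G finite_imp_inj_to_nat_seg [of "edges G"] by (auto simp: finite_graph_def)
  let ?f' = "the_inv_into (edges G) f"
  let ?h' = "the_inv_into (verts G) h"
  define G' where "G' = \<lparr>verts = h ` verts G, edges = f ` edges G, ends = \<lambda>e. h ` ends G (?f' e)\<rparr>"
  have sub: "ends G e \<subseteq> verts G" if "e \<in> edges G" for e
    using G that by (simp add: finite_graph_def)
  have "card (h ` ends G e) = 2" if "e \<in> edges G" for e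
    using G that inj_on_subset [OF h sub [OF that]] by (simp add: finite_graph_def card_image)
  then have fin: "finite_graph G'"
    using G sub f by (fastforce simp: finite_graph_def G'_def the_inv_into_f_f)
  moreover have "G \<preceq>cc G'"
    by (rule cc_le_hom [OF G fin, of h f]) (auto simp: G'_def the_inv_into_f_f f)
  moreover have "G' \<preceq>cc G"
  proof (rule cc_le_hom [OF fin G, of ?h' ?f'])
    fix e assume "e \<in> edges G'"
    then obtain d where d: "d \<in> edges G" "e = f d"
      by (auto simp: G'_def)
    have "?h' ` h ` ends G d = ends G d"
      using sub [OF d(1)] h by (force simp: the_inv_into_f_f image_iff)
    then show "ends G (?f' e) = ?h' ` ends G' e"
      using d f by (simp add: G'_def the_inv_into_f_f)
  qed (auto simp: G'_def the_inv_into_f_f f h)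
  ultimately show ?thesis
    by (rule that)
qed

section \<open>Disjoint unions\<close>

definition graph_sum :: "('v, 'e) graph \<Rightarrow> ('w, 'f) graph \<Rightarrow> ('v + 'w, 'e + 'f) graph" where
  "graph_sum G H = \<lparr>verts = verts G <+> verts H, edges = edges G <+> edges H,
     ends = case_sum (\<lambda>e. Inl ` ends G e) (\<lambda>e. Inr ` ends H e)\<rparr>"

lemma finite_graph_sum:
  "finite_graph G \<Longrightarrow> finite_graph H \<Longrightarrow> finite_graph (graph_sum G H)"
  by (fastforce simp: finite_graph_def graph_sum_def card_image)

lemma cc_le_sum_left:
  "finite_graph G \<Longrightarrow> finite_graph H \<Longrightarrow> G \<preceq>cc graph_sum G H"
  by (rule cc_le_hom [of _ _ Inl Inl]) (auto simp: finite_graph_sum, auto simp: graph_sum_def)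

lemma cc_le_sum_right:
  "finite_graph G \<Longrightarrow> finite_graph H \<Longrightarrow> H \<preceq>cc graph_sum G H"
  by (rule cc_le_hom [of _ _ Inr Inr]) (auto simp: finite_graph_sum, auto simp: graph_sum_def)

lemma Inl_image_eq_doubleton:
  "Inl ` A = {x, y} \<Longrightarrow> \<exists>u v. x = Inl u \<and> y = Inl v \<and> A = {u, v}"
  by (cases x; cases y) (auto simp: set_eq_iff image_iff)

lemma Inr_image_eq_doubleton:
  "Inr ` A = {x, y} \<Longrightarrow> \<exists>u v. x = Inr u \<and> y = Inr v \<and> A = {u, v}"
  by (cases x; cases y) (auto simp: set_eq_iff image_iff)

lemma cc_potential_sum:
  assumes "cc_potential G L \<phi> f" "cc_potential H L \<psi> g"
  shows "cc_potential (graph_sum G H) L (case_sum \<phi> \<psi>) (case_sum f g)"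
  unfolding cc_potential_def
proof (intro conjI ballI allI impI)
  fix e u v assume e: "e \<in> edges (graph_sum G H)" and uv: "ends (graph_sum G H) e = {u, v}"
  show "sym_diff (case_sum \<phi> \<psi> u) (case_sum \<phi> \<psi> v) = ends L (case_sum f g e)"
  proof (cases e)
    case (Inl d)
    then have d: "d \<in> edges G" "Inl ` ends G d = {u, v}"
      using e uv by (auto simp: graph_sum_def)
    obtain u' v' where "u = Inl u'" "v = Inl v'" "ends G d = {u', v'}"
      using Inl_image_eq_doubleton [OF d(2)] by blast
    then show ?thesis
      using assms(1) d(1) Inl by (simp add: cc_potential_def)
  next
    case (Inr d)
    then have d: "d \<in> edges H" "Inr ` ends H d = {u, v}"
      using e uv by (auto simp: graph_sum_def)
    obtain u' v' where "u = Inr u'" "v = Inr v'" "ends H d = {u', v'}"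
      using Inr_image_eq_doubleton [OF d(2)] by blast
    then show ?thesis
      using assms(2) d(1) Inr by (simp add: cc_potential_def)
  qed
next
  show "case_sum f g ` edges (graph_sum G H) \<subseteq> edges L"
    using assms by (auto simp: cc_potential_def graph_sum_def)
  have "\<phi> v \<subseteq> verts L" if "v \<in> verts G" for v
    using assms(1) that unfolding cc_potential_def by blast
  moreover have "\<psi> v \<subseteq> verts L" if "v \<in> verts H" for v
    using assms(2) that unfolding cc_potential_def by blast
  ultimately show "case_sum \<phi> \<psi> ` verts (graph_sum G H) \<subseteq> Pow (verts L)"
    by (force simp: graph_sum_def)
qed

text \<open>Potentials on the summands combine freely since no edge joins them. Together with the
  two injections this makes the disjoint union a join in the quasi-order.\<close>

lemma cc_le_sum:
  assumes "finite_graph G" "finite_graph H" "finite_graph L" "G \<preceq>cc L" "H \<preceq>cc L"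
  shows "graph_sum G H \<preceq>cc L"
  using assms cc_potential_sum by (metis cc_le_iff_potential finite_graph_sum)

section \<open>Targets with a locally bipartite summand\<close>

lemma cc_potential_restrict:
  assumes "cc_potential G H \<phi> f" "f ` edges G \<subseteq> E"
  shows "cc_potential G (H\<lparr>edges := E\<rparr>) \<phi> f"
  using assms by (simp add: cc_potential_def)

text \<open>A bipartite graph can be sent to a single edge \<open>d\<close>: the colour classes get
  the values \<open>ends H d\<close> and \<open>{}\<close>, which differ by exactly the ends of
  \<open>d\<close>.\<close>

lemma cc_potential_bipartite:
  assumes "\<And>e u v. e \<in> edges G \<Longrightarrow> ends G e = {u, v} \<Longrightarrow> c u \<noteq> c v"
    and "finite_graph H" "d \<in> edges H"
  shows "cc_potential G H (\<lambda>v. if c v then ends H d else {}) (\<lambda>_. d)"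
  using assms unfolding cc_potential_def finite_graph_def by auto

text \<open>The image of \<open>G\<close> uses at most \<open>card (edges G)\<close> edges of
  \<open>K\<close>, so \<open>K\<close> can be replaced by a bipartite subgraph, which maps to
  \<open>d\<close>. The target \<open>H\<close> is left general to cover both \<open>G1\<close> and
  the one-edge graph.\<close>

lemma cc_le_sum_locally_bipartite:
  fixes G :: "('a, 'b) graph" and G1 :: "('c, 'd) graph" and K :: "('e, 'f) graph"
  assumes G: "finite_graph G" and G1: "finite_graph G1" and K: "finite_graph K"
    and H: "finite_graph H" and d: "d \<in> edges H" and G1H: "G1 \<preceq>cc H"
    and bip: "\<And>F. F \<subseteq> edges K \<Longrightarrow> card F \<le> card (edges G) \<Longrightarrow>
      \<exists>c :: 'e \<Rightarrow> bool. \<forall>e\<in>F. \<forall>u v. ends K e = {u, v} \<longrightarrow> c u \<noteq> c v"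
    and le: "G \<preceq>cc graph_sum G1 K"
  shows "G \<preceq>cc H"
proof -
  obtain \<phi> f where f: "cc_potential G (graph_sum G1 K) \<phi> f"
    using le G G1 K by (auto simp: cc_le_iff_potential finite_graph_sum)
  have fE: "f ` edges G \<subseteq> edges G1 <+> edges K"
    using f by (simp add: cc_potential_def graph_sum_def)
  define F where "F = {e. Inr e \<in> f ` edges G}"
  have finE: "finite (edges G)"
    using G by (simp add: finite_graph_def)
  have FK: "F \<subseteq> edges K"
    using fE by (auto simp: F_def)
  have "card F = card ((Inr :: 'f \<Rightarrow> 'd + 'f) ` F)"
    by (simp add: card_image)
  also have "\<dots> \<le> card (f ` edges G)"
    using finE by (intro card_mono) (auto simp: F_def)
  also have "\<dots> \<le> card (edges G)"
    using finE by (rule card_image_le)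
  finally have "\<exists>c :: 'e \<Rightarrow> bool. \<forall>e\<in>F. \<forall>u v. ends K e = {u, v} \<longrightarrow> c u \<noteq> c v"
    by (rule bip [OF FK])
  then obtain c :: "'e \<Rightarrow> bool" where
    c: "\<forall>e\<in>F. \<forall>u v. ends K e = {u, v} \<longrightarrow> c u \<noteq> c v" ..
  define K' where "K' = K\<lparr>edges := F\<rparr>"
  have K': "finite_graph K'"
    using K FK finite_subset [OF FK] by (auto simp: finite_graph_def K'_def)
  have "x \<in> edges G1 <+> F" if "x \<in> f ` edges G" for x
    using that fE by (cases x) (auto simp: F_def)
  then have "cc_potential G ((graph_sum G1 K)\<lparr>edges := edges G1 <+> F\<rparr>) \<phi> f"
    by (intro cc_potential_restrict [OF f]) blast
  then have "cc_potential G (graph_sum G1 K') \<phi> f"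
    by (simp add: graph_sum_def K'_def)
  then have "G \<preceq>cc graph_sum G1 K'"
    using G G1 K' by (auto simp: cc_le_iff_potential finite_graph_sum)
  moreover have "K' \<preceq>cc H"
    using cc_potential_bipartite [of K' c, OF _ H d] c K' H
    by (auto simp: K'_def cc_le_iff_potential)
  ultimately show ?thesis
    using cc_le_sum [OF G1 K' H G1H] cc_le_trans by blast
qed

section \<open>Shift graphs\<close>

text \<open>With sets read as increasing tuples, this is the arc from \<open>(x_1, ..., x_k)\<close>
  to \<open>(x_2, ..., x_(k+1))\<close>.\<close>

definition shift_arc :: "nat \<Rightarrow> nat set \<Rightarrow> nat set \<Rightarrow> bool" where
  "shift_arc k A B \<longleftrightarrow>
     (\<exists>C. finite C \<and> card C = Suc k \<and> A = C - {Max C} \<and> B = C - {Min C})"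

lemma shift_arc_finite:
  assumes "shift_arc k A B"
  shows "finite A" "card A = k" "finite B" "card B = k"
proof -
  obtain C where C: "finite C" "card C = Suc k" "A = C - {Max C}" "B = C - {Min C}"
    using assms by (auto simp: shift_arc_def)
  then have "C \<noteq> {}"
    by auto
  then show "finite A" "card A = k" "finite B" "card B = k"
    using C by auto
qed

text \<open>Ramsey's theorem gives a set \<open>C\<close> of size \<open>Suc k\<close> whose
  \<open>k\<close>-subsets all have one colour; removing its maximum or its minimum gives the two
  ends of an arc. The bound \<open>M\<close> depends on the colour set and \<open>k\<close>, not on
  the colouring.\<close>

lemma shift_arc_same_colour:
  fixes P :: "'p set"
  assumes "finite P"
  obtains M where "\<And>c. c ` nsets {..<M} k \<subseteq> P \<Longrightarrow>
    \<exists>A\<in>nsets {..<M} k. \<exists>B\<in>nsets {..<M} k. shift_arc k A B \<and> c A = c B"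
proof -
  obtain M :: nat where M: "partn_lst {..<M} (replicate (card P) (Suc k)) k"
    using ramsey_full by blast
  obtain h :: "'p \<Rightarrow> nat" where h: "bij_betw h P {..<card P}"
    using assms finite_same_card_bij [of P "{..<card P}"] by auto
  have "\<exists>A\<in>nsets {..<M} k. \<exists>B\<in>nsets {..<M} k. shift_arc k A B \<and> c A = c B"
    if c: "c ` nsets {..<M} k \<subseteq> P" for c
  proof -
    have "h \<circ> c \<in> nsets {..<M} k \<rightarrow> {..<card P}"
      using c bij_betw_apply [OF h] by (auto simp: image_subset_iff)
    then obtain i C where i: "i < card P" and "C \<in> nsets {..<M} (replicate (card P) (Suc k) ! i)"
      and mono: "(h \<circ> c) ` nsets C k \<subseteq> {i}"
      using M by (fastforce simp: partn_lst_def monochromatic_def)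
    then have C: "C \<subseteq> {..<M}" "finite C" "card C = Suc k"
      by (auto simp: nsets_def)
    let ?A = "C - {Max C}" and ?B = "C - {Min C}"
    have arc: "shift_arc k ?A ?B"
      using C by (auto simp: shift_arc_def)
    have AB: "?A \<in> nsets C k" "?B \<in> nsets C k"
      using shift_arc_finite [OF arc] by (auto simp: nsets_def)
    then have "h (c ?A) = h (c ?B)"
      using mono by (auto simp: image_subset_iff)
    moreover have AB': "?A \<in> nsets {..<M} k" "?B \<in> nsets {..<M} k"
      using AB nsets_mono [OF C(1)] by auto
    moreover have "c ?A \<in> P" "c ?B \<in> P"
      using c AB' by auto
    ultimately have "c ?A = c ?B"
      using inj_onD [OF bij_betw_imp_inj_on [OF h]] by blast
    then show ?thesis
      using arc AB' by blast
  qed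
  then show ?thesis
    by (rule that)
qed

section \<open>Positions of elements along walks in the shift graph\<close>

definition rank :: "nat set \<Rightarrow> nat \<Rightarrow> nat" where
  "rank A x = card {y \<in> A. y < x}"

text \<open>Passing from \<open>C\<close> to \<open>B\<close> drops the minimum, which lies below
  \<open>x\<close>; passing from \<open>C\<close> to \<open>A\<close> drops only the maximum, which
  lies above it.\<close>

lemma rank_shift:
  assumes "shift_arc k A B" "x \<in> A" "x \<in> B"
  shows "rank A x = Suc (rank B x)"
proof -
  obtain C where C: "finite C" "A = C - {Max C}" "B = C - {Min C}"
    using assms by (auto simp: shift_arc_def)
  have "C \<noteq> {}" "x \<in> C" "x \<noteq> Max C" "x \<noteq> Min C"
    using assms C by auto
  then have "Min C < x" "x < Max C"
    using C(1) by (simp_all add: order.strict_iff_order)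
  then have "{y \<in> A. y < x} = insert (Min C) {y \<in> B. y < x}"
    using C Min_in [OF C(1) \<open>C \<noteq> {}\<close>] by auto
  then show ?thesis
    using C by (simp add: rank_def)
qed

text \<open>Only the least element of \<open>A\<close>, the one of rank 0, disappears along the
  arc.\<close>

lemma mem_shift_forward:
  assumes "shift_arc k A B" "x \<in> A" "0 < rank A x"
  shows "x \<in> B"
proof (rule ccontr)
  obtain C where C: "finite C" "A = C - {Max C}" "B = C - {Min C}"
    using assms by (auto simp: shift_arc_def)
  assume "x \<notin> B"
  then have "x = Min C"
    using C assms by auto
  then have "{y \<in> A. y < x} = {}"
    using C by (auto simp: not_less)
  then show False
    using assms(3) by (simp only: rank_def card.empty)
qed

text \<open>Against the arc only the greatest element of \<open>B\<close> disappears, and it has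
  rank \<open>k - 1\<close>.\<close>

lemma mem_shift_backward:
  assumes "shift_arc k A B" "x \<in> B" "Suc (rank B x) < k"
  shows "x \<in> A"
proof (rule ccontr)
  obtain C where C: "finite C" "A = C - {Max C}" "B = C - {Min C}"
    using assms by (auto simp: shift_arc_def)
  assume "x \<notin> A"
  then have "x = Max C"
    using C assms by auto
  then have "{y \<in> B. y < x} = B - {x}"
    using C by (auto simp: order.strict_iff_order)
  then show False
    using assms shift_arc_finite [OF assms(1)] by (simp add: rank_def)
qed

lemma ex_rank:
  assumes "finite A" "i < card A"
  obtains x where "x \<in> A" "rank A x = i"
proof -
  obtain h where h: "bij_betw h {..<card A} A" "strict_mono_on {..<card A} h"
    using ex_bij_betw_strict_mono_card [OF assms(1)] by blast
  have "{y \<in> A. y < h i} = h ` {..<i}"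
  proof -
    have "h j < h i \<longleftrightarrow> j < i" if "j < card A" for j
      using h(2) assms(2) that by (auto simp: strict_mono_on_less)
    then show ?thesis
      using h(1) assms(2) unfolding bij_betw_def by fastforce
  qed
  moreover have "inj_on h {..<i}"
    using h(1) assms(2) by (auto simp: bij_betw_def intro: inj_on_subset)
  ultimately have "rank A (h i) = i"
    by (simp add: rank_def card_image)
  moreover have "h i \<in> A"
    using h(1) assms(2) by (auto simp: bij_betw_def)
  ultimately show ?thesis
    using that by blast
qed

text \<open>Each step moves the rank by one, up or down, and an element can be lost only at position
  0 or \<open>k - 1\<close>. Starting at least \<open>n\<close> positions from both ends, it
  survives \<open>n\<close> steps.\<close>

lemma mem_shift_walk:
  assumes "S \<subseteq> {(A, B). shift_arc k A B \<or> shift_arc k B A}"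
    and "(A, B) \<in> S ^^ n" "x \<in> A" "n \<le> rank A x" "rank A x + n < k"
  shows "x \<in> B \<and> rank A x \<le> rank B x + n \<and> rank B x \<le> rank A x + n"
  using assms(2,4,5)
proof (induction n arbitrary: B)
  case 0
  then show ?case
    using assms(3) by simp
next
  case (Suc n)
  then obtain D where D: "(A, D) \<in> S ^^ n" "(D, B) \<in> S"
    by auto
  have x: "x \<in> D" "rank A x \<le> rank D x + n" "rank D x \<le> rank A x + n"
    using Suc.IH [OF D(1)] Suc.prems by auto
  have "shift_arc k D B \<or> shift_arc k B D"
    using assms(1) D(2) by auto
  then show ?case
  proof
    assume arc: "shift_arc k D B"
    have "x \<in> B"
      using mem_shift_forward [OF arc x(1)] x Suc.prems by simp
    then show ?thesis
      using rank_shift [OF arc x(1)] x by simp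
  next
    assume arc: "shift_arc k B D"
    have "x \<in> B"
      using mem_shift_backward [OF arc x(1)] x Suc.prems by simp
    then show ?thesis
      using rank_shift [OF arc _ x(1)] x by simp
  qed
qed

text \<open>
  An element in the middle of one vertex of a small connected subgraph lies in all vertices of the
  subgraph, and its rank changes parity along every edge.
\<close>

lemma shift_arcs_bipartite:
  assumes "finite R" and R: "R \<subseteq> {(A, B). shift_arc k A B}" and k: "4 * card R < k"
  obtains c :: "nat set \<Rightarrow> bool" where "\<And>A B. (A, B) \<in> R \<Longrightarrow> c A \<noteq> c B"
proof -
  define S where "S = R \<union> R\<inverse>"
  define s where "s = card S"
  have finS: "finite S"
    using assms(1) by (simp add: S_def)
  have "s \<le> card R + card (R\<inverse>)"
    unfolding s_def S_def by (rule card_Un_le)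
  \<comment> \<open>The factor 4 in the hypothesis pays twice: once for adding the reversed arcs,
    once for keeping rank \<open>s\<close> at distance at least \<open>s\<close> from both
    ends.\<close>
  then have sk: "2 * s < k"
    using k by simp
  have symS: "sym (S\<^sup>*)"
    by (rule sym_rtrancl) (auto simp: S_def sym_def)
  have S: "S \<subseteq> {(A, B). shift_arc k A B \<or> shift_arc k B A}"
    using R by (auto simp: S_def)
  \<comment> \<open>A representative of the connected component of \<open>A\<close>. The choice
    depends only on the set of vertices reachable from \<open>A\<close>, so it agrees throughout a
    component.\<close>
  define r where "r A = (SOME B. (A, B) \<in> S\<^sup>*)" for A
  define m where "m B = (SOME x. x \<in> B \<and> rank B x = s)" for B
  have r: "(A, r A) \<in> S\<^sup>*" for A
    unfolding r_def by (rule someI [of _ A]) simp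
  \<comment> \<open>The marked element has rank \<open>s\<close> in the representative, and some
    walk from there to \<open>A\<close> has length at most \<open>s\<close>, so the element is never
    lost.\<close>
  have mid: "m (r A) \<in> A" if "finite A" "card A = k" for A
  proof -
    have "finite B \<and> card B = k" if "(A, B) \<in> S\<^sup>*" for B
      using that
    proof (induction rule: rtrancl_induct)
      case base
      show ?case
        using \<open>finite A\<close> \<open>card A = k\<close> by simp
    next
      case (step B D)
      then show ?case
        using S shift_arc_finite by blast
    qed
    then have "finite (r A)" "s < card (r A)"
      using r sk by auto
    then have x: "m (r A) \<in> r A \<and> rank (r A) (m (r A)) = s"
      unfolding m_def by (rule_tac someI_ex) (metis ex_rank)
    have "(r A, A) \<in> S\<^sup>*"
      using symS r by (meson symD)
    then obtain n where "n \<le> s" "(r A, A) \<in> S ^^ n"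
      using finS by (auto simp: rtrancl_finite_eq_relpow s_def)
    then show ?thesis
      using mem_shift_walk [OF S, of "r A" A n "m (r A)"] x sk by simp
  qed
  have "even (rank A (m (r A))) \<noteq> even (rank B (m (r B)))" if AB: "(A, B) \<in> R" for A B
  proof -
    have arc: "shift_arc k A B"
      using AB R by auto
    have "(A, B) \<in> S\<^sup>*" "(B, A) \<in> S\<^sup>*"
      using AB by (auto simp: S_def)
    then have "(A, D) \<in> S\<^sup>* \<longleftrightarrow> (B, D) \<in> S\<^sup>*" for D
      by (meson rtrancl_trans)
    then have "r A = r B"
      by (simp add: r_def)
    then show ?thesis
      using rank_shift [OF arc, of "m (r A)"] mid [of A] mid [of B] shift_arc_finite [OF arc]
      by simp
  qed
  then show ?thesis
    by (rule that)
qed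

section \<open>Products with shift graphs\<close>

text \<open>The categorical product with the shift graph. Edges are vertex pairs, so parallel edges
  of \<open>G\<close> are merged.\<close>

definition shift_product ::
    "('v, 'e) graph \<Rightarrow> nat \<Rightarrow> nat \<Rightarrow> ('v \<times> nat set, ('v \<times> nat set) set) graph" where
  "shift_product G k M = \<lparr>verts = verts G \<times> nsets {..<M} k,
     edges = {{(g, A), (g', B)} | g g' A B. (\<exists>e\<in>edges G. ends G e = {g, g'}) \<and>
       A \<in> nsets {..<M} k \<and> B \<in> nsets {..<M} k \<and> shift_arc k A B},
     ends = \<lambda>e. e\<rparr>"

lemma ends_shift_product [simp]: "ends (shift_product G k M) e = e"
  by (simp add: shift_product_def)

lemma shift_product_edgeI:
  assumes "e \<in> edges G" "ends G e = {g, g'}"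
    and "A \<in> nsets {..<M} k" "B \<in> nsets {..<M} k" "shift_arc k A B"
  shows "{(g, A), (g', B)} \<in> edges (shift_product G k M)"
  unfolding shift_product_def graph.select_convs mem_Collect_eq
  by (intro exI [of _ g] exI [of _ g'] exI [of _ A] exI [of _ B] conjI refl bexI [of _ e] assms)

lemma shift_product_edgeE:
  assumes "finite_graph G" "d \<in> edges (shift_product G k M)"
  obtains g g' A B e where "d = {(g, A), (g', B)}" "e \<in> edges G" "ends G e = {g, g'}" "g \<noteq> g'"
    "g \<in> verts G" "g' \<in> verts G"
    "A \<in> nsets {..<M} k" "B \<in> nsets {..<M} k" "shift_arc k A B"
proof -
  obtain g g' A B e where *: "d = {(g, A), (g', B)}" "e \<in> edges G" "ends G e = {g, g'}"
    "A \<in> nsets {..<M} k" "B \<in> nsets {..<M} k" "shift_arc k A B"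
    using assms(2) by (auto simp: shift_product_def)
  have "card {g, g'} = 2" "{g, g'} \<subseteq> verts G"
    using assms(1) *(2,3) by (metis finite_graph_def)+
  then have "g \<noteq> g'" "g \<in> verts G" "g' \<in> verts G"
    by auto
  then show ?thesis
    using that * by blast
qed

lemma finite_graph_shift_product:
  assumes "finite_graph G"
  shows "finite_graph (shift_product G k M)"
proof -
  let ?K = "shift_product G k M"
  have fin: "finite (verts ?K)"
    using assms by (simp add: shift_product_def finite_graph_def finite_imp_finite_nsets)
  have e: "ends ?K d = d \<and> d \<subseteq> verts ?K \<and> card d = 2" if "d \<in> edges ?K" for d
    using assms that by (rule shift_product_edgeE) (simp add: shift_product_def)
  then have "edges ?K \<subseteq> Pow (verts ?K)"
    by blast
  then have "finite (edges ?K)"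
    using fin by (simp add: finite_subset)
  then show ?thesis
    using fin e by (simp add: finite_graph_def)
qed

lemma shift_product_cc_le:
  assumes "finite_graph G"
  shows "shift_product G k M \<preceq>cc G"
proof -
  let ?K = "shift_product G k M"
  \<comment> \<open>The projection \<open>fst\<close> is a homomorphism; as parallel edges were
    merged, one edge of \<open>G\<close> with the projected ends has to be chosen.\<close>
  define f where "f d = (SOME e. e \<in> edges G \<and> ends G e = fst ` d)" for d :: "('a \<times> nat set) set"
  have f: "f d \<in> edges G \<and> ends G (f d) = fst ` d" if "d \<in> edges ?K" for d
    using assms that
  proof (rule shift_product_edgeE)
    fix g g' A B e assume "d = {(g, A), (g', B)}" "e \<in> edges G" "ends G e = {g, g'}"
    then have "e \<in> edges G \<and> ends G e = fst ` d"
      by simp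
    then show ?thesis
      unfolding f_def by (rule someI)
  qed
  show ?thesis
  proof (rule cc_le_hom [OF finite_graph_shift_product [OF assms] assms, where h = fst and f = f])
    show "fst ` verts ?K \<subseteq> verts G"
      by (auto simp: shift_product_def)
    show "f ` edges ?K \<subseteq> edges G"
      using f by auto
    show "ends G (f d) = fst ` ends ?K d" if "d \<in> edges ?K" for d
      using f [OF that] by simp
  qed
qed

text \<open>The second coordinates of the edges in \<open>F\<close> give at most
  \<open>card F\<close> shift arcs, and a 2-colouring of those is pulled back along
  \<open>snd\<close>.\<close>

lemma shift_product_bipartite:
  assumes "finite_graph G" "F \<subseteq> edges (shift_product G k M)" "4 * card F < k"
  obtains c :: "_ \<Rightarrow> bool" where "\<And>u v. {u, v} \<in> F \<Longrightarrow> c u \<noteq> c v"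
proof -
  have "\<forall>d\<in>F. \<exists>A B. shift_arc k A B \<and> (\<exists>g g'. d = {(g, A), (g', B)})"
    using shift_product_edgeE [OF assms(1)] assms(2) by (metis subsetD)
  then obtain a b where ab: "\<And>d. d \<in> F \<Longrightarrow> shift_arc k (a d) (b d)"
    "\<And>d. d \<in> F \<Longrightarrow> \<exists>g g'. d = {(g, a d), (g', b d)}"
    by metis
  have finF: "finite F"
    using finite_graph_shift_product [OF assms(1)] assms(2)
    by (auto simp: finite_graph_def intro: finite_subset)
  let ?R = "(\<lambda>d. (a d, b d)) ` F"
  have "4 * card ?R < k"
    using card_image_le [OF finF, of "\<lambda>d. (a d, b d)"] assms(3) by linarith
  moreover have "?R \<subseteq> {(A, B). shift_arc k A B}"
    using ab(1) by auto
  ultimately obtain c :: "nat set \<Rightarrow> bool" where c: "\<And>A B. (A, B) \<in> ?R \<Longrightarrow> c A \<noteq> c B"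
    using shift_arcs_bipartite [of ?R k] finF by blast
  have "c (snd u) \<noteq> c (snd v)" if uv: "{u, v} \<in> F" for u v
  proof -
    have "c (a {u, v}) \<noteq> c (b {u, v})"
      using c uv by auto
    moreover obtain g g' where "{u, v} = {(g, a {u, v}), (g', b {u, v})}"
      using ab(2) [OF uv] by blast
    then have "{snd u, snd v} = {a {u, v}, b {u, v}}"
      unfolding doubleton_eq_iff by (metis snd_conv)
    ultimately show ?thesis
      unfolding doubleton_eq_iff by metis
  qed
  then show ?thesis
    using that [of "\<lambda>u. c (snd u)"] by blast
qed

text \<open>Adjacent \<open>A\<close> and \<open>B\<close> with the same fibre colour act like a
  loop in the shift graph, and the product of \<open>G\<close> with a loop is \<open>G\<close> up to
  parallel edges.\<close>

lemma shift_product_not_cc_le: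
  assumes G: "finite_graph G" and H: "finite_graph H" and GH: "\<not> G \<preceq>cc H"
  obtains M where "\<not> shift_product G k M \<preceq>cc H"
proof -
  have "finite (verts G \<rightarrow>\<^sub>E Pow (verts H))"
    using G H by (auto simp: finite_graph_def intro: finite_PiE)
  then obtain M where M: "\<And>c. c ` nsets {..<M} k \<subseteq> (verts G \<rightarrow>\<^sub>E Pow (verts H)) \<Longrightarrow>
      \<exists>A\<in>nsets {..<M} k. \<exists>B\<in>nsets {..<M} k. shift_arc k A B \<and> c A = c B"
    using shift_arc_same_colour [where k = k] by blast
  let ?K = "shift_product G k M"
  have "\<not> ?K \<preceq>cc H"
  proof
    assume "?K \<preceq>cc H"
    then obtain \<phi> f where f: "cc_potential ?K H \<phi> f"
      using G H by (auto simp: cc_le_iff_potential finite_graph_shift_product)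
    have \<phi>V: "\<phi> (g, A) \<subseteq> verts H" if "g \<in> verts G" "A \<in> nsets {..<M} k" for g A
    proof -
      have "(g, A) \<in> verts ?K"
        using that by (simp add: shift_product_def)
      then show ?thesis
        using f unfolding cc_potential_def by blast
    qed
    \<comment> \<open>Restricting to \<open>verts G\<close> puts the colours into a finite function
      space, as Ramsey's theorem requires.\<close>
    define c where "c A = restrict (\<lambda>g. \<phi> (g, A)) (verts G)" for A
    have "c ` nsets {..<M} k \<subseteq> (verts G \<rightarrow>\<^sub>E Pow (verts H))"
      unfolding c_def using \<phi>V by (intro image_subsetI restrict_PiE_iff [THEN iffD2]) blast
    then obtain A B where AB: "A \<in> nsets {..<M} k" "B \<in> nsets {..<M} k" "shift_arc k A B"
      and cAB: "c A = c B"
      using M by blast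
    have eq: "\<phi> (g, A) = \<phi> (g, B)" if "g \<in> verts G" for g
      using fun_cong [OF cAB, of g] that by (simp add: c_def)
    have "\<exists>d\<in>edges H. \<forall>u v. ends G e = {u, v} \<longrightarrow> sym_diff (\<phi> (u, A)) (\<phi> (v, A)) = ends H d"
      if e: "e \<in> edges G" for e
    proof -
      obtain g g' where g: "ends G e = {g, g'}" "g \<noteq> g'" "g \<in> verts G" "g' \<in> verts G"
        using finite_graph_endsE [OF G e] .
      let ?d = "{(g, A), (g', B)}"
      have d: "?d \<in> edges ?K"
        using e g(1) AB by (rule shift_product_edgeI)
      \<comment> \<open>The product edge gives this with \<open>\<phi> (g', B)\<close>, which equals
        \<open>\<phi> (g', A)\<close> by the choice of \<open>A\<close> and
        \<open>B\<close>.\<close>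
      have sd: "sym_diff (\<phi> (g, A)) (\<phi> (g', A)) = ends H (f ?d)"
        using f d eq [OF g(4)] by (simp add: cc_potential_def)
      have "sym_diff (\<phi> (u, A)) (\<phi> (v, A)) = ends H (f ?d)" if "ends G e = {u, v}" for u v
      proof -
        have "u = g \<and> v = g' \<or> u = g' \<and> v = g"
          using that g(1) by (simp add: doubleton_eq_iff) blast
        then show ?thesis
          using sd by (auto simp: Un_commute)
      qed
      moreover have "f ?d \<in> edges H"
        using f d by (auto simp: cc_potential_def)
      ultimately show ?thesis
        by blast
    qed
    then obtain f' where "\<And>e. e \<in> edges G \<Longrightarrow> f' e \<in> edges H \<and>
        (\<forall>u v. ends G e = {u, v} \<longrightarrow> sym_diff (\<phi> (u, A)) (\<phi> (v, A)) = ends H (f' e))"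
      by metis
    then have "cc_potential G H (\<lambda>g. \<phi> (g, A)) f'"
      using \<phi>V [OF _ AB(1)] unfolding cc_potential_def by blast
    then show False
      using GH G H by (auto simp: cc_le_iff_potential)
  qed
  then show ?thesis
    by (rule that)
qed

section \<open>Density\<close>

lemma finite_complete_graph: "finite_graph (complete_graph n)"
proof -
  have "finite {e. e \<subseteq> {1..n} \<and> card e = 2}"
    by (rule finite_subset [of _ "Pow {1..n}"]) auto
  then show ?thesis
    by (auto simp: finite_graph_def complete_graph_def)
qed

lemma edges_complete_graph_1: "edges (complete_graph 1) = {}"
proof -
  have "card e \<noteq> 2" if "e \<subseteq> {1}" for e :: "nat set"
    using card_mono [OF _ that] by auto
  then show ?thesis
    by (auto simp: complete_graph_def)
qed

lemma edges_complete_graph_2: "edges (complete_graph 2) = {{1, 2}}"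
proof -
  have "e = {1, 2}" if "e \<subseteq> {1..2}" "card e = 2" for e :: "nat set"
  proof -
    have "e = {1..2}"
      using that by (intro card_subset_eq) auto
    then show ?thesis
      by auto
  qed
  then show ?thesis
    by (auto simp: complete_graph_def)
qed

lemma complete_graph_2_cc_le:
  assumes "finite_graph G" "edges G \<noteq> {}"
  shows "complete_graph 2 \<preceq>cc G"
proof -
  obtain e where e: "e \<in> edges G"
    using assms(2) by auto
  have "cc_potential (complete_graph 2) G (\<lambda>v. if v = 1 then ends G e else {}) (\<lambda>_. e)"
  proof (rule cc_potential_bipartite [OF _ assms(1) e])
    fix d u v assume "d \<in> edges (complete_graph 2)" "ends (complete_graph 2) d = {u, v}"
    then have "{1, 2} = {u, v}"
      by (simp add: edges_complete_graph_2) (simp add: complete_graph_def)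
    then show "(u = 1) \<noteq> (v = 1)"
      by (auto simp: doubleton_eq_iff)
  qed
  then show ?thesis
    using assms(1) finite_complete_graph by (auto simp: cc_le_iff_potential)
qed

theorem theorem2:
  fixes G1 :: "('a, 'b) graph" and G2 :: "('c, 'd) graph"
  assumes "finite_graph G1" and "finite_graph G2"
    and "G1 \<prec>cc G2"
    and "\<not> (G1 \<approx>cc complete_graph 1 \<and> G2 \<approx>cc complete_graph 2)"
  shows "\<exists>G :: (nat, nat) graph. finite_graph G \<and> G1 \<prec>cc G \<and> G \<prec>cc G2"
proof -
  note G1 = assms(1) and G2 = assms(2)
  have le: "G1 \<preceq>cc G2" and nle: "\<not> G2 \<preceq>cc G1"
    using assms(3) by (auto simp: cc_less_def)
  \<comment> \<open>Large enough that any \<open>card (edges G2)\<close> edges of the product form a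
    bipartite graph; \<open>M\<close> is chosen afterwards, for this \<open>k\<close>.\<close>
  define k where "k = Suc (4 * card (edges G2))"
  obtain M where M: "\<not> shift_product G2 k M \<preceq>cc G1"
    using shift_product_not_cc_le [OF G2 G1 nle] .
  let ?K = "shift_product G2 k M"
  let ?S = "graph_sum G1 ?K"
  have K: "finite_graph ?K"
    using G2 by (rule finite_graph_shift_product)
  have bip: "\<exists>c :: _ \<Rightarrow> bool. \<forall>e\<in>F. \<forall>u v. ends ?K e = {u, v} \<longrightarrow> c u \<noteq> c v"
    if F: "F \<subseteq> edges ?K" "card F \<le> card (edges G2)" for F
  proof -
    have "4 * card F < k"
      using F(2) by (simp add: k_def)
    then obtain c :: "_ \<Rightarrow> bool" where c: "\<And>u v. {u, v} \<in> F \<Longrightarrow> c u \<noteq> c v"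
      using shift_product_bipartite [OF G2 F(1)] by blast
    have "\<forall>e\<in>F. \<forall>u v. ends ?K e = {u, v} \<longrightarrow> c u \<noteq> c v"
      by (metis c ends_shift_product)
    then show ?thesis
      by blast
  qed
  have "\<not> G2 \<preceq>cc ?S"
  proof
    assume S: "G2 \<preceq>cc ?S"
    show False
    proof (cases "edges G1 = {}")
      \<comment> \<open>An edge of \<open>G1\<close> absorbs the bipartite part, so
        \<open>G2\<close> would map to \<open>G1\<close>.\<close>
      case False
      then obtain d where "d \<in> edges G1"
        by auto
      moreover have "G1 \<preceq>cc G1"
        by (rule cc_le_hom [OF G1 G1, of id id]) auto
      ultimately show False
        using cc_le_sum_locally_bipartite [OF G2 G1 K G1 _ _ bip S] nle by blast
    next
      \<comment> \<open>Without an edge in \<open>G1\<close> the bipartite part goes to the edge of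
        \<open>complete_graph 2\<close>, which leads to exactly the excluded pair.\<close>
      case True
      have "edges G2 \<noteq> {}"
        using cc_le_edgeless [OF G2 G1] nle by auto
      then have "complete_graph 2 \<preceq>cc G2"
        by (rule complete_graph_2_cc_le [OF G2])
      moreover have "G2 \<preceq>cc complete_graph 2"
      proof (rule cc_le_sum_locally_bipartite [OF G2 G1 K finite_complete_graph _ _ bip S])
        show "{1, 2} \<in> edges (complete_graph 2)"
          by (simp add: edges_complete_graph_2)
        show "G1 \<preceq>cc complete_graph 2"
          by (rule cc_le_edgeless [OF G1 finite_complete_graph True])
      qed
      moreover have "G1 \<approx>cc complete_graph 1"
        unfolding cc_equiv_def
        using cc_le_edgeless [OF G1 finite_complete_graph True]
          cc_le_edgeless [OF finite_complete_graph G1 edges_complete_graph_1] by blast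
      ultimately show False
        using assms(4) by (simp add: cc_equiv_def)
    qed
  qed
  moreover have "?S \<preceq>cc G2"
    using cc_le_sum [OF G1 K G2 le shift_product_cc_le [OF G2]] .
  moreover have "G1 \<preceq>cc ?S"
    using cc_le_sum_left [OF G1 K] .
  moreover have "\<not> ?S \<preceq>cc G1"
    using M cc_le_sum_right [OF G1 K] cc_le_trans by blast
  moreover obtain G :: "(nat, nat) graph" where "finite_graph G" "?S \<preceq>cc G" "G \<preceq>cc ?S"
    using nat_graph_copy [OF finite_graph_sum [OF G1 K]] .
  ultimately show ?thesis
    unfolding cc_less_def by (meson cc_le_trans)
qed

end
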